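(* Let $n\ge 1$ be an integer. (I) Let $p$ be an odd prime dividing $n$, let $r=v_p(n)$, and let $k$ be an integer. If $n-k$ is not divisible by $p-1$, then $$c(n,k)\equiv 0 \pmod{p^r}.$$ If on the other hand $n-k=\ell(p-1)$ for an integer $\ell$, then $$c(n,k)\equiv (-1)^\ell\binom{n/p}{\ell}\pmod{p^r}.$$ (II) Assume that $n$ is even, let $r=v_2(n)$, and let $k$ be an integer. (a) Suppose $r\ge 3$. If $n-k=2\ell+1$ with $\ell$ an integer, then $$c(n,k)\equiv(-1)^\ell\binom{n/4}{\ell}\frac n2\pmod{2^r}.$$ If $n-k=2\ell$ with $\ell$ an integer, then $$c(n,k)\equiv(-1)^\ell\left[\binom{n/4}{\ell}-\frac n2\binom{n/4}{\ell-1}\right]\pmod{2^r}.$$ (b) Suppose $r=1$. Then $$c(n,k)\equiv\binom{n/2}{n-k}\pmod 2.$$ (c) Suppose $r=2$. If $n-k=2\ell$ with $\ell$ an integer, then $$c(n,k)\equiv(-1)^\ell\binom{n/4}{\ell}\pmod 4,$$ while if $n-k=2\ell+1$ with $\ell$ an integer, then $$c(n,k)\equiv(-1)^\ell\binom{n/4}{\ell}\frac n2\pmod 4.$$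
   Context: For a nonzero integer $n$ and a prime $p$, $v_p(n)$ denotes the exponent of the highest power of $p$ dividing $n$. The numbers $c(n,k)$ are the signless Stirling numbers of the first kind, defined by the polynomial identity $\prod_{j=0}^{n-1}(1+jt)=\sum_{k=0}^{n}c(n,k)\,t^{n-k}$ in $\mathbb{Z}[t]$, with $c(n,k)=0$ for $k<0$ or $k>n$. Binomial coefficients $\binom{N}{j}$ (with $N\ge 0$ an integer) are $0$ when $j<0$ or $j>N$. *)

theory Defs
  imports
    "HOL-Combinatorics.Stirling"
    "HOL-Computational_Algebra.Polynomial"
    "HOL-Computational_Algebra.Primes"
    "HOL-Number_Theory.Cong"
begin

text \<open>
  The signless Stirling number $c(n,k)$ for an arbitrary integer $k$. For $k > n$ the library's
  \<open>stirling\<close> is already zero; the lemma \<open>prod_one_plus_eq_sum_stirling1\<close> below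
  is the polynomial identity that characterises these numbers.
\<close>

definition stirling1 :: "nat \<Rightarrow> int \<Rightarrow> int" where
  "stirling1 n k = (if k < 0 then 0 else int (stirling n (nat k)))"

text \<open>
  The binomial coefficient with an integer lower argument. The library's \<open>choose\<close> only takes
  natural numbers and already vanishes when the lower argument exceeds the upper one.
\<close>

definition int_binomial :: "nat \<Rightarrow> int \<Rightarrow> int" where
  "int_binomial N j = (if j < 0 then 0 else int (N choose nat j))"

text \<open>
  The integer $(-1)^\ell$ for an integer $\ell$ of either sign: type \<open>int\<close> has no
  inverse, hence no integer exponents, but $(-1)^\ell = (-1)^{|\ell|}$.
\<close>

definition neg_one_pow :: "int \<Rightarrow> int" where
  "neg_one_pow l = (-1) ^ nat \<bar>l\<bar>"

lemma stirling1_of_nat [simp]: "stirling1 n (int k) = int (stirling n k)"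
  by (simp add: stirling1_def)

lemma stirling1_eq_0: "k < 0 \<or> k > int n \<Longrightarrow> stirling1 n k = 0"
  by (auto simp: stirling1_def)

lemma int_binomial_eq_0: "j < 0 \<or> j > int N \<Longrightarrow> int_binomial N j = 0"
  by (auto simp: int_binomial_def binomial_eq_0)

lemma coeff_prod_one_plus:
  "coeff (\<Prod>j<n. [:1, int j:]) m = (if m \<le> n then int (stirling n (n - m)) else 0)"
proof (induction n arbitrary: m)
  case 0
  show ?case by (simp add: coeff_eq_0)
next
  case (Suc n)
  have "coeff (\<Prod>j<Suc n. [:1, int j:]) m =
      coeff (\<Prod>j<n. [:1, int j:]) m +
      (case m of 0 \<Rightarrow> 0 | Suc m' \<Rightarrow> int n * coeff (\<Prod>j<n. [:1, int j:]) m')"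
    by (simp add: mult.commute coeff_pCons split: nat.split)
  also have "\<dots> = (if m \<le> Suc n then int (stirling (Suc n) (Suc n - m)) else 0)"
  proof (cases m)
    case 0
    then show ?thesis by (simp add: Suc.IH)
  next
    case (Suc m')
    consider "m \<le> n" | "m = Suc n" | "m > Suc n" by linarith
    then show ?thesis
    proof cases
      case 1
      then have "Suc n - m = Suc (n - m)" "n - m' = Suc (n - m)"
        using Suc by linarith+
      with 1 Suc show ?thesis by (simp add: Suc.IH)
    next
      case 2
      have "n = 0 \<or> stirling n 0 = 0" by (cases n) auto
      then show ?thesis using 2 Suc by (auto simp: Suc.IH)
    next
      case 3
      then show ?thesis using Suc by (simp add: Suc.IH)
    qed
  qed
  finally show ?case .
qed

lemma prod_one_plus_eq_sum_stirling1:
  "(\<Prod>j<n. [:1, int j:]) = (\<Sum>k\<le>n. monom (stirling1 n (int k)) (n - k))"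
proof -
  let ?P = "\<Prod>j<n. [:1, int j:]"
  have "degree ?P \<le> n"
    by (rule degree_le) (simp add: coeff_prod_one_plus)
  then have "?P = (\<Sum>m\<le>n. monom (coeff ?P m) m)"
    by (simp add: poly_as_sum_of_monoms')
  also have "\<dots> = (\<Sum>m\<le>n. monom (int (stirling n (n - m))) m)"
    by (intro sum.cong) (auto simp: coeff_prod_one_plus)
  also have "\<dots> = (\<Sum>k\<le>n. monom (stirling1 n (int k)) (n - k))"
    by (rule sum.reindex_bij_witness[of _ "\<lambda>k. n - k" "\<lambda>m. n - m"]) (auto simp: of_nat_diff stirling1_def nat_diff_distrib)
  finally show ?thesis .
qed

end

theory Submission
  imports "HOL-Number_Theory.Residues" Defs
begin

text \<open>
  The Stirling numbers \<open>c(n,k)\<close> are the coefficients of \<open>F\<^sub>n(t) = \<Prod>j<n. (1 + j t)\<close>, so the theorem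
  is a set of congruences between polynomials, read off coefficient by coefficient. For a prime
  \<open>p\<close> and \<open>n = m p\<^sup>r\<close>, the factors of \<open>F\<^sub>n\<close> are periodic modulo \<open>p\<^sup>r\<close>, hence \<open>F\<^sub>n\<close> is congruent to the
  \<open>m\<close>-th power of the product for \<open>p\<^sup>r\<close>, and only \<open>n = p\<^sup>r\<close> needs work.

  For odd \<open>p\<close>, let \<open>N = p\<^sup>r\<close>. Grouping the factors of \<open>F\<close> at \<open>p N\<close> by the residue of the index modulo
  \<open>N\<close> gives products \<open>\<Prod>a<p. (x + a N t)\<close>, each congruent to \<open>x ^ p\<close> modulo \<open>p N\<close>, because
  \<open>0 + 1 + \<dots> + (p - 1)\<close> is a multiple of \<open>p\<close> and \<open>N\<^sup>2\<close> is a multiple of \<open>p N\<close>. So passing from \<open>N\<close> to \<open>p N\<close> raises \<open>F\<close> to the \<open>p\<close>-th power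
  (\<open>rising_prod_odd_mult_cong\<close>). Since \<open>p\<close>-th powers also improve congruences by a factor \<open>p\<close>
  (\<open>ring_cong_power_lift\<close>), the case \<open>r = 1\<close> propagates: \<open>F\<close> at \<open>p\<close> is \<open>1 - t ^ (p - 1)\<close> modulo \<open>p\<close> by
  Lagrange and Fermat (\<open>rising_prod_prime_cong\<close>), hence \<open>F\<^sub>n\<close> is \<open>(1 - t ^ (p - 1)) ^ (n / p)\<close>
  modulo \<open>p\<^sup>r\<close>.

  For \<open>p = 2\<close> the same scheme works from \<open>r = 2\<close> on (\<open>rising_prod_four_mult_cong\<close>), starting from
  \<open>F\<^sub>4(t) = (1 - t\<^sup>2) (1 + 2 t)\<close> modulo 4. Thus \<open>F\<^sub>n\<close> is \<open>((1 - t\<^sup>2) (1 + 2 t)) ^ (n / 4)\<close> modulo \<open>2\<^sup>r\<close>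
  (\<open>rising_prod_two_adic_cong\<close>), and the second factor becomes \<open>1 + (n / 2) (t + t\<^sup>2)\<close> if \<open>r \<ge> 3\<close>, by
  squaring \<open>1 + 2 t\<close> once and applying \<open>one_plus_4_power_cong\<close>, and \<open>1 + (n / 2) t\<close> if \<open>r = 2\<close>. For
  \<open>r = 1\<close> periodicity alone gives \<open>(1 + t) ^ (n / 2)\<close> modulo 2.
\<close>

section \<open>Congruences in commutative rings\<close>

text \<open>
  The ring \<open>\<int>[t]\<close> is not Euclidean, so a congruence is taken to be divisibility of the
  difference, in an arbitrary commutative ring.
\<close>

definition ring_cong :: "'a::comm_ring_1 \<Rightarrow> 'a \<Rightarrow> 'a \<Rightarrow> bool" where
  "ring_cong m a b \<longleftrightarrow> m dvd a - b"

lemma ring_cong_refl [simp]: "ring_cong m a a"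
  by (simp add: ring_cong_def)

lemma ring_cong_trans [trans]: "ring_cong m a b \<Longrightarrow> ring_cong m b c \<Longrightarrow> ring_cong m a c"
  unfolding ring_cong_def using dvd_add[of m "a - b" "b - c"] by simp

lemma ring_cong_mult:
  assumes "ring_cong m a b" "ring_cong m c d"
  shows "ring_cong m (a * c) (b * d)"
proof -
  have "a * c - b * d = (a - b) * c + b * (c - d)" by (simp add: algebra_simps)
  with assms show ?thesis unfolding ring_cong_def by (metis dvd_add dvd_mult dvd_mult2)
qed

lemma ring_cong_prod:
  "(\<And>i. i \<in> A \<Longrightarrow> ring_cong m (f i) (g i)) \<Longrightarrow> ring_cong m (prod f A) (prod g A)"
  by (induction A rule: infinite_finite_induct) (auto intro: ring_cong_mult)

lemma ring_cong_power: "ring_cong m a b \<Longrightarrow> ring_cong m (a ^ k) (b ^ k)"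
  by (induction k) (auto intro: ring_cong_mult)

lemma ring_cong_modulus_dvd: "ring_cong m a b \<Longrightarrow> d dvd m \<Longrightarrow> ring_cong d a b"
  unfolding ring_cong_def using dvd_trans by blast

lemma of_nat_dvd_of_nat: "a dvd b \<Longrightarrow> (of_nat a :: 'a::comm_ring_1) dvd of_nat b"
  by (auto elim!: dvdE)

text \<open>
  Each \<open>p\<close>-th power gains a factor \<open>p\<close> in the modulus. This drives all inductions on the
  exponent of the prime.
\<close>

lemma ring_cong_power_lift:
  fixes a b m :: "'a::comm_ring_1"
  assumes ab: "ring_cong m a b" and p: "of_nat p dvd m"
  shows "ring_cong (of_nat p * m) (a ^ p) (b ^ p)"
proof -
  have "of_nat p dvd a - b" using ab p unfolding ring_cong_def by (rule dvd_trans[rotated])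
  then have ab': "ring_cong (of_nat p) a b" by (simp add: ring_cong_def)
  \<comment> \<open>The cofactor of \<open>a - b\<close> in \<open>a ^ p - b ^ p\<close> is a sum of \<open>p\<close> terms that all agree modulo \<open>p\<close>.\<close>
  have "ring_cong (of_nat p) (b ^ (p - Suc i) * a ^ i) (b ^ (p - 1))" if "i < p" for i
  proof -
    have "ring_cong (of_nat p) (b ^ (p - Suc i) * a ^ i) (b ^ (p - Suc i) * b ^ i)"
      by (intro ring_cong_mult ring_cong_power ab') simp
    moreover have "b ^ (p - Suc i) * b ^ i = b ^ (p - 1)"
      using that by (simp flip: power_add)
    ultimately show ?thesis by simp
  qed
  then have "of_nat p dvd (\<Sum>i<p. b ^ (p - Suc i) * a ^ i - b ^ (p - 1))"
    by (intro dvd_sum) (auto simp: ring_cong_def)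
  then have "of_nat p dvd (\<Sum>i<p. b ^ (p - Suc i) * a ^ i) - of_nat p * b ^ (p - 1)"
    by (simp add: sum_subtractf)
  then have "of_nat p dvd (\<Sum>i<p. b ^ (p - Suc i) * a ^ i)"
    by (metis diff_add_cancel dvd_add dvd_triv_left)
  with ab have "m * of_nat p dvd (a - b) * (\<Sum>i<p. b ^ (p - Suc i) * a ^ i)"
    unfolding ring_cong_def by (rule mult_dvd_mono)
  then show ?thesis by (simp add: ring_cong_def power_diff_sumr2 mult.commute)
qed

text \<open>
  If each term is congruent to the \<open>p\<close>-th power of its predecessor modulo the next power of \<open>p\<close>,
  then lifting carries one initial congruence along the whole sequence. For odd primes the initial exponent is \<open>i = 1\<close>; for
  the prime 2 it is \<open>i = 2\<close>, because there the recursion only holds from that point on.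
\<close>

lemma ring_cong_power_lift_iterate:
  fixes F :: "nat \<Rightarrow> 'a::comm_ring_1"
  assumes base: "ring_cong (of_nat (p ^ i)) (F i) a" and "i \<ge> 1"
    and step: "\<And>r. r \<ge> i \<Longrightarrow> ring_cong (of_nat (p ^ Suc r)) (F (Suc r)) (F r ^ p)"
    and "r \<ge> i"
  shows "ring_cong (of_nat (p ^ r)) (F r) (a ^ p ^ (r - i))"
  using \<open>r \<ge> i\<close>
proof (induction r rule: dec_induct)
  case base
  show ?case using assms(1) by simp
next
  case (step r)
  have "p dvd p ^ r" using step \<open>i \<ge> 1\<close> by (simp add: dvd_power)
  then have "ring_cong (of_nat p * of_nat (p ^ r)) (F r ^ p) ((a ^ p ^ (r - i)) ^ p)"
    using step.IH by (intro ring_cong_power_lift of_nat_dvd_of_nat)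
  moreover have "(a ^ p ^ (r - i)) ^ p = a ^ p ^ (Suc r - i)"
    using step by (simp add: Suc_diff_le mult.commute flip: power_mult)
  ultimately have "ring_cong (of_nat (p ^ Suc r)) (F r ^ p) (a ^ p ^ (Suc r - i))"
    by simp
  with assms(3)[OF step(1)] show ?case by (rule ring_cong_trans)
qed

lemma one_plus_power_cong: "ring_cong (y\<^sup>2) ((1 + y) ^ m) (1 + of_nat m * y)"
proof (induction m)
  case (Suc m)
  have "ring_cong (y\<^sup>2) ((1 + y) ^ Suc m) ((1 + y) * (1 + of_nat m * y))"
    using Suc by (auto intro: ring_cong_mult)
  also have "ring_cong (y\<^sup>2) ((1 + y) * (1 + of_nat m * y)) (1 + of_nat (Suc m) * y)"
    unfolding ring_cong_def
    by (rule dvdI[of _ _ "of_nat m"]) (simp add: algebra_simps power2_eq_square)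
  finally show ?case .
qed simp

lemma one_plus_4_power_two_power_cong:
  fixes u :: "'a::comm_ring_1"
  shows "ring_cong (2 ^ (s + 3)) ((1 + 4 * u) ^ 2 ^ s) (1 + 2 ^ (s + 2) * u)"
proof (induction s)
  case (Suc s)
  have "ring_cong (of_nat 2 * 2 ^ (s + 3)) (((1 + 4 * u) ^ 2 ^ s) ^ 2) ((1 + 2 ^ (s + 2) * u) ^ 2)"
    by (rule ring_cong_power_lift[OF Suc]) (simp add: dvd_power)
  also have "((1 + 4 * u) ^ 2 ^ s) ^ 2 = (1 + 4 * u) ^ 2 ^ Suc s"
    by (simp add: mult.commute flip: power_mult)
  also have "of_nat 2 * 2 ^ (s + 3) = (2 ^ (Suc s + 3) :: 'a)"
    by (simp flip: power_Suc)
  also have "ring_cong (2 ^ (Suc s + 3)) ((1 + 2 ^ (s + 2) * u) ^ 2) (1 + 2 ^ (Suc s + 2) * u)"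
    unfolding ring_cong_def
    by (rule dvdI[of _ _ "2 ^ s * u ^ 2"]) (simp add: algebra_simps power2_eq_square power_add)
  finally show ?case .
qed simp

text \<open>
  In the binomial expansion every term beyond the linear one vanishes to the given 2-adic
  precision, since \<open>4 ^ k / k\<close> has 2-adic valuation at least 3 for \<open>k \<ge> 2\<close>. Squaring repeatedly and then
  raising to the power \<open>m\<close> avoids the 2-adic valuation of binomial coefficients.
\<close>

lemma one_plus_4_power_cong:
  fixes u :: "'a::comm_ring_1"
  shows "ring_cong (2 ^ (s + 3)) ((1 + 4 * u) ^ (2 ^ s * m)) (1 + of_nat (2 ^ (s + 2) * m) * u)"
proof -
  let ?y = "2 ^ (s + 2) * u"
  have "ring_cong (2 ^ (s + 3)) (((1 + 4 * u) ^ 2 ^ s) ^ m) ((1 + ?y) ^ m)"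
    by (intro ring_cong_power one_plus_4_power_two_power_cong)
  also have "ring_cong (2 ^ (s + 3)) ((1 + ?y) ^ m) (1 + of_nat m * ?y)"
    by (rule ring_cong_modulus_dvd[OF one_plus_power_cong], rule dvdI[of _ _ "2 ^ (s + 1) * u ^ 2"])
       (simp add: algebra_simps power2_eq_square power_add)
  finally show ?thesis by (simp only: power_mult of_nat_mult of_nat_power of_nat_numeral mult.assoc mult.left_commute[of "of_nat m"])
qed

section \<open>Products over residue classes\<close>

text \<open>
  This is the reversed rising factorial; in \<open>\<int>[t]\<close> it is the generating polynomial of the signless
  Stirling numbers of the first kind. The argument \<open>t\<close> may lie in any commutative ring because the
  congruences below are obtained from its factors one by one.
\<close>

definition rising_prod :: "nat \<Rightarrow> 'a::comm_ring_1 \<Rightarrow> 'a" where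
  "rising_prod n t = (\<Prod>j<n. 1 + of_nat j * t)"

text \<open>
  The indices below \<open>m * N\<close> are grouped by their residue \<open>j\<close> modulo \<open>N\<close>. Each group is a
  short arithmetic progression whose step \<open>N t\<close> is small for the moduli of interest.
\<close>

lemma rising_prod_mult:
  "rising_prod (m * N) t =
     (\<Prod>j<N. \<Prod>a<m. (1 + of_nat j * t) + of_nat a * (of_nat N * t))"
proof -
  have block: "(\<Prod>i\<in>{a * N..<a * N + N}. 1 + of_nat i * t) =
      (\<Prod>j<N. (1 + of_nat j * t) + of_nat a * (of_nat N * t))" for a
    by (rule prod.reindex_bij_witness[of _ "\<lambda>j. a * N + j" "\<lambda>i. i - a * N"])
       (auto simp: algebra_simps simp flip: of_nat_mult of_nat_add)
  have "rising_prod (m * N) t = (\<Prod>a<m. \<Prod>i\<in>{a * N..<a * N + N}. 1 + of_nat i * t)"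
    by (simp add: rising_prod_def prod.nat_group)
  also have "\<dots> = (\<Prod>a<m. \<Prod>j<N. (1 + of_nat j * t) + of_nat a * (of_nat N * t))"
    by (simp only: block)
  also have "\<dots> = (\<Prod>j<N. \<Prod>a<m. (1 + of_nat j * t) + of_nat a * (of_nat N * t))"
    by (rule prod.swap)
  finally show ?thesis .
qed

lemma rising_prod_mult_cong:
  "ring_cong (of_nat N) (rising_prod (m * N) t) (rising_prod N t ^ m)"
proof -
  have "ring_cong (of_nat N) (\<Prod>a<m. (1 + of_nat j * t) + of_nat a * (of_nat N * t))
          (\<Prod>a<m. 1 + of_nat j * t)" for j
    by (intro ring_cong_prod) (simp add: ring_cong_def)
  then have "ring_cong (of_nat N) (rising_prod (m * N) t) (\<Prod>j<N. \<Prod>a<m. 1 + of_nat j * t)"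
    unfolding rising_prod_mult by (rule ring_cong_prod)
  then show ?thesis by (simp add: rising_prod_def prod_power_distrib)
qed

lemma prod_arith_progression_cong:
  "ring_cong (y\<^sup>2) (\<Prod>a<Suc m. x + of_nat a * y) (x ^ Suc m + of_nat (Suc m choose 2) * x ^ m * y)"
proof (induction m)
  case 0
  show ?case by (simp add: ring_cong_def numeral_2_eq_2)
next
  case (Suc m)
  let ?B = "of_nat (Suc m choose 2) :: 'a"
  have "ring_cong (y\<^sup>2) (\<Prod>a<Suc (Suc m). x + of_nat a * y)
      ((x ^ Suc m + ?B * x ^ m * y) * (x + of_nat (Suc m) * y))"
    using Suc unfolding prod.lessThan_Suc[of _ "Suc m"] by (intro ring_cong_mult) simp_all
  also have "ring_cong (y\<^sup>2) \<dots>
      (x ^ Suc (Suc m) + of_nat (Suc (Suc m) choose 2) * x ^ Suc m * y)"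
  proof -
    have "Suc (Suc m) choose 2 = (Suc m choose 2) + Suc m"
      by (simp add: numeral_2_eq_2)
    then show ?thesis unfolding ring_cong_def
      by (intro dvdI[of _ _ "?B * x ^ m * of_nat (Suc m)"])
         (simp add: algebra_simps power2_eq_square del: binomial_Suc_Suc)
  qed
  finally show ?case .
qed

text \<open>
  The step \<open>y = N t\<close> of each residue group has \<open>y\<^sup>2\<close> divisible by \<open>p * N\<close>, and its linear
  contribution carries the factor \<open>p choose 2\<close>. So each group collapses to a \<open>p\<close>-th power.
\<close>

lemma rising_prod_odd_mult_cong:
  fixes t :: "'a::comm_ring_1"
  assumes "odd p" "p dvd N"
  shows "ring_cong (of_nat (p * N)) (rising_prod (p * N) t) (rising_prod N t ^ p)"
proof -
  let ?y = "of_nat N * t"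
  have "ring_cong (of_nat (p * N)) (\<Prod>a<p. x + of_nat a * ?y) (x ^ p)" for x :: 'a
  proof -
    obtain m where m: "p = Suc (2 * m)" using \<open>odd p\<close> by (metis oddE Suc_eq_plus1)
    \<comment> \<open>This is where \<open>p\<close> must be odd: the linear term of the inner product becomes divisible by \<open>p\<close>.\<close>
    have choose: "p choose 2 = p * m" by (simp add: choose_two m)
    have "ring_cong (?y\<^sup>2) (\<Prod>a<p. x + of_nat a * ?y) (x ^ p + of_nat (p choose 2) * x ^ (2 * m) * ?y)"
      unfolding m by (rule prod_arith_progression_cong)
    moreover have "of_nat (p * N) dvd ?y\<^sup>2"
      using \<open>p dvd N\<close> by (auto elim!: dvdE simp: power2_eq_square mult_ac)
    ultimately have "ring_cong (of_nat (p * N)) (\<Prod>a<p. x + of_nat a * ?y)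
        (x ^ p + of_nat (p choose 2) * x ^ (2 * m) * ?y)"
      by (rule ring_cong_modulus_dvd)
    also have "ring_cong (of_nat (p * N)) \<dots> (x ^ p)"
      unfolding ring_cong_def
      by (rule dvdI[of _ _ "of_nat m * x ^ (2 * m) * t"]) (simp add: choose algebra_simps)
    finally show ?thesis .
  qed
  then have "ring_cong (of_nat (p * N)) (rising_prod (p * N) t) (\<Prod>j<N. (1 + of_nat j * t) ^ p)"
    unfolding rising_prod_mult by (intro ring_cong_prod)
  then show ?thesis by (simp add: rising_prod_def prod_power_distrib)
qed

text \<open>
  For the prime 2 the factor \<open>2 choose 2 = 1\<close> kills nothing, so doubling is not compared with
  squaring factor by factor. Grouping modulo \<open>M\<close> on both sides, with four factors against the
  square of two, makes the linear terms \<open>6 x\<^sup>3 y\<close> and \<open>2 x\<^sup>3 y\<close> agree modulo \<open>4 * M\<close>.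
\<close>

lemma rising_prod_four_mult_cong:
  fixes t :: "'a::comm_ring_1"
  assumes "even M"
  shows "ring_cong (of_nat (4 * M)) (rising_prod (4 * M) t) (rising_prod (2 * M) t ^ 2)"
proof -
  let ?y = "of_nat M * t"
  obtain L where L: "M = 2 * L" using assms by blast
  have "ring_cong (of_nat (4 * M)) (\<Prod>a<4. x + of_nat a * ?y) ((\<Prod>a<2. x + of_nat a * ?y) ^ 2)"
    for x :: 'a
    unfolding ring_cong_def
    \<comment> \<open>With \<open>y = M t\<close> the difference is \<open>4x\<^sup>3y + 10x\<^sup>2y\<^sup>2 + 6xy\<^sup>3\<close>; the last two terms need \<open>M\<close> even.\<close>
    by (rule dvdI[of _ _ "x^3 * t + 5 * x^2 * t^2 * of_nat L + 6 * x * t^3 * of_nat L ^ 2"])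
       (simp add: eval_nat_numeral L algebra_simps)
  then have "ring_cong (of_nat (4 * M)) (rising_prod (4 * M) t)
      (\<Prod>j<M. (\<Prod>a<2. (1 + of_nat j * t) + of_nat a * ?y) ^ 2)"
    unfolding rising_prod_mult by (intro ring_cong_prod)
  then show ?thesis by (simp only: rising_prod_mult prod_power_distrib)
qed

lemma rising_prod_2: "rising_prod 2 t = 1 + t"
  by (simp add: rising_prod_def numeral_2_eq_2)

section \<open>The product modulo an odd prime power\<close>

text \<open>
  Lagrange's bound on the number of roots modulo a prime, for integer polynomials: a root is split
  off by synthetic division, and primality passes the other roots on to the quotient.
\<close>

lemma const_poly_dvd_if_many_roots:
  fixes g :: "int poly"
  assumes "finite A" "prime p" "degree g < card A"
    and "\<And>a. a \<in> A \<Longrightarrow> p dvd poly g a"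
    and "\<And>a b. a \<in> A \<Longrightarrow> b \<in> A \<Longrightarrow> p dvd a - b \<Longrightarrow> a = b"
  shows "[:p:] dvd g"
  using assms(1,3-)
proof (induction A arbitrary: g rule: finite_induct)
  case (insert a A)
  define q where "q = synthetic_div g a"
  have g: "g = [:-a, 1:] * q + [:poly g a:]"
    unfolding q_def by (rule synthetic_div_correct'[symmetric])
  have "[:p:] dvd q"
  proof (cases "degree g = 0")
    case True
    then have "q = 0" by (simp add: q_def synthetic_div_eq_0_iff)
    then show ?thesis by simp
  next
    case False
    show ?thesis
    proof (rule insert.IH)
      show "degree q < card A"
        using insert.prems(1) insert.hyps False by (simp add: q_def degree_synthetic_div)
      fix b assume b: "b \<in> A"
      have "(b - a) * poly q b = poly g b - poly g a"
        using arg_cong[OF g, of "\<lambda>g. poly g b"] by (simp add: algebra_simps)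
      moreover have "p dvd poly g b - poly g a"
        using insert.prems(2) b by (intro dvd_diff) auto
      ultimately have "p dvd (b - a) * poly q b" by simp
      moreover have "\<not> p dvd b - a"
        using insert.prems(3)[of b a] b insert.hyps by auto
      ultimately show "p dvd poly q b" using \<open>prime p\<close> by (simp add: prime_dvd_mult_iff)
    qed (use insert.prems(3) in auto)
  qed
  moreover have "[:p:] dvd [:poly g a:]" using insert.prems(2) by simp
  ultimately show ?case by (subst g) (intro dvd_add dvd_mult)
qed simp

abbreviation polyX :: "int poly" where "polyX \<equiv> [:0, 1:]"

lemma rising_prod_polyX: "rising_prod n polyX = (\<Prod>j<n. [:1, int j:])"
  by (simp add: rising_prod_def of_nat_poly one_pCons)

lemma coeff_rising_prod:
  "coeff (rising_prod n polyX) m = (if m \<le> n then int (stirling n (n - m)) else 0)"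
  unfolding rising_prod_polyX by (rule coeff_prod_one_plus)

text \<open>
  The difference of both sides has degree less than \<open>p\<close> and vanishes modulo \<open>p\<close> at all \<open>p\<close>
  residues. At 0 both sides are 1; at \<open>a \<noteq> 0\<close> the product has the factor with \<open>j\<close> congruent to
  \<open>-1/a\<close>, and the right-hand side vanishes by Fermat's little theorem.
\<close>

lemma rising_prod_prime_cong:
  assumes p: "prime p"
  shows "ring_cong (of_nat p) (rising_prod p polyX) (1 - polyX ^ (p - 1))"
proof -
  let ?g = "rising_prod p polyX - (1 - polyX ^ (p - 1))"
  have p2: "p \<ge> 2" using p by (rule prime_ge_2_nat)
  have "degree (rising_prod p polyX) \<le> p - 1"
  proof (rule degree_le, intro allI impI)
    fix i assume "i > p - 1"
    \<comment> \<open>The factor with \<open>j = 0\<close> is 1, so already the coefficient at \<open>p\<close> vanishes.\<close>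
    then show "coeff (rising_prod p polyX) i = 0"
      using p2 by (cases "i = p"; cases p) (auto simp: coeff_rising_prod)
  qed
  moreover have "degree (1 - polyX ^ (p - 1)) \<le> p - 1"
    by (rule degree_diff_le) (auto simp: degree_power_eq)
  ultimately have "degree ?g \<le> p - 1" by (rule degree_diff_le)
  then have deg: "degree ?g < card (int ` {..<p})"
    using p2 by (simp add: card_image)
  have "[:int p:] dvd ?g"
  proof (rule const_poly_dvd_if_many_roots[OF _ _ deg])
    fix a assume "a \<in> int ` {..<p}"
    then obtain k where k: "a = int k" "k < p" by auto
    have eval: "poly ?g a = (\<Prod>j<p. 1 + int j * a) - (1 - a ^ (p - 1))"
      by (simp add: rising_prod_polyX poly_prod mult.commute)
    show "int p dvd poly ?g a"
    proof (cases "k = 0")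
      case True
      then show ?thesis using p2 unfolding eval by (simp add: k power_0_left)
    next
      case False
      then have ndvd: "\<not> p dvd k" using k(2) by (auto dest: dvd_imp_le)
      then have "[k ^ (p - 1) = 1] (mod p)" using p by (intro fermat_theorem)
      then have "[int (k ^ (p - 1)) = int 1] (mod int p)" by (simp only: cong_int_iff)
      then have fermat: "int p dvd a ^ (p - 1) - 1"
        by (simp add: k cong_iff_dvd_diff)
      have "coprime k p" using ndvd p by (metis prime_imp_coprime coprime_commute)
      then obtain x where x: "[a * x = 1] (mod int p)"
        using cong_solve_coprime_int[of a "int p"] k by auto
      \<comment> \<open>The factor that vanishes modulo \<open>p\<close> at \<open>a\<close> is the one with \<open>j\<close> congruent to \<open>-1/a\<close>.\<close>
      define j where "j = nat ((- x) mod int p)"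
      have j: "j < p" "int j = (- x) mod int p"
        using p2 by (auto simp: j_def nat_less_iff)
      have "[1 + int j * a = 1 + (- x) * a] (mod int p)"
        unfolding j by (intro cong_add cong_mult cong_mod_left) auto
      also have "[1 + (- x) * a = 0] (mod int p)"
        using x by (simp add: cong_iff_dvd_diff) (metis dvd_minus_iff minus_diff_eq mult.commute)
      finally have "int p dvd 1 + int j * a" by (simp add: cong_0_iff)
      moreover have "1 + int j * a dvd (\<Prod>j<p. 1 + int j * a)"
        using j by (intro dvd_prodI) auto
      ultimately have "int p dvd (\<Prod>j<p. 1 + int j * a)" by (rule dvd_trans)
      with fermat show ?thesis unfolding eval
        by (metis dvd_add diff_diff_eq2 add_diff_eq)
    qed
  next
    fix a b assume "a \<in> int ` {..<p}" "b \<in> int ` {..<p}" "int p dvd a - b"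
    then show "a = b"
      by (auto simp: cong_less_modulus_unique_nat cong_int_iff simp flip: cong_iff_dvd_diff)
  qed (use p in auto)
  then show ?thesis by (simp add: ring_cong_def of_nat_poly)
qed

lemma rising_prod_prime_power_cong:
  assumes "prime p" "odd p" "r \<ge> 1"
  shows "ring_cong (of_nat (p ^ r)) (rising_prod (p ^ r) polyX)
           ((1 - polyX ^ (p - 1)) ^ p ^ (r - 1))"
proof (rule ring_cong_power_lift_iterate)
  fix r :: nat assume "r \<ge> 1"
  then show "ring_cong (of_nat (p ^ Suc r)) (rising_prod (p ^ Suc r) polyX) (rising_prod (p ^ r) polyX ^ p)"
    using rising_prod_odd_mult_cong[of p "p ^ r" polyX] assms by (simp add: dvd_power)
qed (use assms rising_prod_prime_cong in auto)

text \<open>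
  With \<open>n = m p\<^sup>r\<close>, the factors of the product repeat modulo \<open>p\<^sup>r\<close> with period \<open>p\<^sup>r\<close>, so it is the
  \<open>m\<close>-th power of the product for \<open>p\<^sup>r\<close>.
\<close>

lemma rising_prod_odd_prime_cong:
  assumes "prime p" "odd p" "p dvd n" "n > 0"
  shows "ring_cong (of_nat (p ^ multiplicity p n)) (rising_prod n polyX)
           ((1 - polyX ^ (p - 1)) ^ (n div p))"
proof -
  define r where "r = multiplicity p n"
  obtain m where n: "n = m * p ^ r"
    using multiplicity_dvd[of p n] unfolding r_def by (metis dvd_div_mult_self)
  have "multiplicity p n \<ge> 1"
    using assms by (intro multiplicity_geI) auto
  then obtain s where r: "r = Suc s" by (auto simp: r_def dest: Suc_le_D)
  have "ring_cong (of_nat (p ^ r)) (rising_prod n polyX) (rising_prod (p ^ r) polyX ^ m)"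
    unfolding n by (rule rising_prod_mult_cong)
  also have "ring_cong (of_nat (p ^ r)) \<dots> (((1 - polyX ^ (p - 1)) ^ p ^ (r - 1)) ^ m)"
    using assms r by (intro ring_cong_power rising_prod_prime_power_cong) auto
  also have "\<dots> = (1 - polyX ^ (p - 1)) ^ (n div p)"
    using assms by (simp add: n r mult.commute flip: power_mult)
  finally show ?thesis by (simp add: r_def)
qed

section \<open>The product modulo a power of two\<close>

lemma rising_prod_4_cong:
  "ring_cong 4 (rising_prod 4 t) ((1 - t ^ 2) * (1 + 2 * t))"
  unfolding ring_cong_def
  by (rule dvdI[of _ _ "t + 3 * t ^ 2 + 2 * t ^ 3"])
     (simp add: rising_prod_def eval_nat_numeral algebra_simps)

text \<open>
  The case \<open>r = 2\<close> is a direct expansion. It is the right starting point since the squaring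
  recursion fails one step earlier: \<open>1 + t\<close> squared is \<open>1 + 2 t + t\<^sup>2\<close>, not congruent to
  \<open>(1 - t\<^sup>2) (1 + 2 t)\<close> modulo 4.
\<close>

lemma rising_prod_two_power_cong:
  assumes "r \<ge> 2"
  shows "ring_cong (of_nat (2 ^ r)) (rising_prod (2 ^ r) t)
           (((1 - t ^ 2) * (1 + 2 * t)) ^ 2 ^ (r - 2))"
proof (rule ring_cong_power_lift_iterate)
  show "ring_cong (of_nat (2 ^ 2)) (rising_prod (2 ^ 2) t) ((1 - t ^ 2) * (1 + 2 * t))"
    using rising_prod_4_cong by simp
  fix r :: nat assume "r \<ge> 2"
  then obtain q where "r = Suc (Suc q)" by (metis le_Suc_ex add_2_eq_Suc)
  then show "ring_cong (of_nat (2 ^ Suc r)) (rising_prod (2 ^ Suc r) t) (rising_prod (2 ^ r) t ^ 2)"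
    using rising_prod_four_mult_cong[of "2 * 2 ^ q" t] by simp
qed (use assms in auto)

lemma rising_prod_two_adic_cong:
  assumes "n = 2 ^ r * m" "r \<ge> 2"
  shows "ring_cong (of_nat (2 ^ r)) (rising_prod n t)
           ((1 - t ^ 2) ^ (n div 4) * (1 + 2 * t) ^ (n div 4))"
proof -
  obtain s where r: "r = Suc (Suc s)"
    using \<open>r \<ge> 2\<close> by (metis le_Suc_ex add_2_eq_Suc)
  have "ring_cong (of_nat (2 ^ r)) (rising_prod n t) (rising_prod (2 ^ r) t ^ m)"
    unfolding assms(1) mult.commute[of _ m] by (rule rising_prod_mult_cong)
  also have "ring_cong (of_nat (2 ^ r)) \<dots> ((((1 - t ^ 2) * (1 + 2 * t)) ^ 2 ^ (r - 2)) ^ m)"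
    by (intro ring_cong_power rising_prod_two_power_cong assms)
  also have "\<dots> = ((1 - t ^ 2) * (1 + 2 * t)) ^ (n div 4)"
    by (simp add: assms(1) r flip: power_mult)
  finally show ?thesis by (simp add: power_mult_distrib)
qed

lemma rising_prod_multiplicity_2_cong:
  assumes "n = 4 * m"
  shows "ring_cong 4 (rising_prod n t) ((1 - t ^ 2) ^ (n div 4) * (1 + of_nat (n div 2) * t))"
proof -
  have "ring_cong 4 (rising_prod n t) ((1 - t ^ 2) ^ (n div 4) * (1 + 2 * t) ^ (n div 4))"
    using rising_prod_two_adic_cong[of n 2 m t] assms by simp
  also have "ring_cong 4 ((1 + 2 * t) ^ (n div 4)) (1 + of_nat (n div 4) * (2 * t))"
    by (rule ring_cong_modulus_dvd[OF one_plus_power_cong]) (simp add: power_mult_distrib)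
  then have "ring_cong 4 ((1 - t ^ 2) ^ (n div 4) * (1 + 2 * t) ^ (n div 4))
      ((1 - t ^ 2) ^ (n div 4) * (1 + of_nat (n div 4) * (2 * t)))"
    by (intro ring_cong_mult ring_cong_refl)
  also have "of_nat (n div 4) * (2 * t) = of_nat (n div 2) * t"
    using assms by (simp add: mult_ac)
  finally show ?thesis .
qed

text \<open>
  Since \<open>n div 4\<close> is even here, \<open>(1 + 2 t) ^ (n div 4)\<close> is a power of
  \<open>(1 + 2 t)\<^sup>2 = 1 + 4 (t + t\<^sup>2)\<close>, to which \<open>one_plus_4_power_cong\<close> applies.
\<close>

lemma rising_prod_multiplicity_ge_3_cong:
  assumes "n = 2 ^ r * m" "r \<ge> 3"
  shows "ring_cong (of_nat (2 ^ r)) (rising_prod n t)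
           ((1 - t ^ 2) ^ (n div 4) * (1 + of_nat (n div 2) * (t + t ^ 2)))"
proof -
  define s where "s = r - 3"
  have r: "r = s + 3" using assms(2) by (simp add: s_def)
  have quarter: "n div 4 = 2 * (2 ^ s * m)" and half: "n div 2 = 2 ^ (s + 2) * m"
    by (simp_all add: assms(1) r power_add)
  have "(1 + 2 * t) ^ (n div 4) = ((1 + 2 * t) ^ 2) ^ (2 ^ s * m)"
    by (simp only: quarter power_mult)
  also have "\<dots> = (1 + 4 * (t + t ^ 2)) ^ (2 ^ s * m)"
    by (rule arg_cong[of _ _ "\<lambda>x. x ^ (2 ^ s * m)"]) (simp add: power2_eq_square algebra_simps)
  also have "ring_cong (of_nat (2 ^ r)) \<dots> (1 + of_nat (n div 2) * (t + t ^ 2))"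
    using one_plus_4_power_cong[of s "t + t ^ 2" m] unfolding r half of_nat_power of_nat_numeral .
  finally have "ring_cong (of_nat (2 ^ r)) ((1 - t ^ 2) ^ (n div 4) * (1 + 2 * t) ^ (n div 4))
      ((1 - t ^ 2) ^ (n div 4) * (1 + of_nat (n div 2) * (t + t ^ 2)))"
    by (intro ring_cong_mult ring_cong_refl)
  with rising_prod_two_adic_cong[OF assms(1), of t] assms(2) show ?thesis
    by (auto intro: ring_cong_trans)
qed

section \<open>Comparison of coefficients\<close>

lemma ring_cong_imp_coeff_cong:
  "ring_cong (of_nat m) f g \<Longrightarrow> [coeff f i = coeff g i] (mod int m)"
  by (simp add: ring_cong_def of_nat_poly const_poly_dvd_iff cong_iff_dvd_diff)

text \<open>
  The index \<open>k\<close> may be negative: then \<open>i\<close> exceeds \<open>n\<close> and both sides vanish.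
\<close>

lemma stirling1_eq_coeff:
  "int n - k = int i \<Longrightarrow> stirling1 n k = coeff (rising_prod n polyX) i"
  by (auto simp: coeff_rising_prod stirling1_def nat_diff_distrib' of_nat_diff intro!: arg_cong[of _ _ "stirling n"])

lemma stirling1_cong_of_ring_cong:
  assumes "ring_cong (of_nat m) (rising_prod n polyX) g" "int n - k = int i"
  shows "[stirling1 n k = coeff g i] (mod int m)"
  using ring_cong_imp_coeff_cong[OF assms(1)] by (simp add: stirling1_eq_coeff[OF assms(2)])

lemma coeff_one_minus_X_power:
  assumes "d > 0"
  shows "coeff ((1 - polyX ^ d) ^ m) i =
           (if d dvd i then (- 1) ^ (i div d) * int (m choose (i div d)) else 0)"
proof -
  have "(1 - polyX ^ d) ^ m = (monom (- 1) d + 1) ^ m"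
    by (simp add: monom_altdef)
  also have "\<dots> = (\<Sum>l\<le>m. monom ((- 1) ^ l * int (m choose l)) (d * l))"
    by (subst binomial_ring) (simp add: monom_power of_nat_poly smult_monom mult.commute)
  finally have "coeff ((1 - polyX ^ d) ^ m) i =
      (\<Sum>l\<le>m. if d * l = i then (- 1) ^ l * int (m choose l) else 0)"
    by (simp add: coeff_sum)
  also have "\<dots> = (\<Sum>l\<le>m. if l = i div d then
      (if d dvd i then (- 1) ^ (i div d) * int (m choose (i div d)) else 0) else 0)"
    using assms by (intro sum.cong) auto
  also have "\<dots> = (if d dvd i then (- 1) ^ (i div d) * int (m choose (i div d)) else 0)"
    by (auto simp: binomial_eq_0)
  finally show ?thesis .
qed

lemma coeff_linear_factor:
  "coeff (f * (1 + of_nat c * polyX)) i =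
     coeff f i + int c * (case i of 0 \<Rightarrow> 0 | Suc j \<Rightarrow> coeff f j)"
proof -
  have "f * (1 + of_nat c * polyX) = f + smult (int c) (pCons 0 f)"
    by (simp add: of_nat_poly algebra_simps)
  then show ?thesis by (simp add: coeff_pCons split: nat.split)
qed

lemma coeff_quadratic_factor:
  "coeff (f * (1 + of_nat c * (polyX + polyX ^ 2))) i =
     coeff f i + int c * ((case i of 0 \<Rightarrow> 0 | Suc j \<Rightarrow> coeff f j) +
                          (case i of Suc (Suc j) \<Rightarrow> coeff f j | _ \<Rightarrow> 0))"
proof -
  have "f * (1 + of_nat c * (polyX + polyX ^ 2)) = f + smult (int c) (pCons 0 f + pCons 0 (pCons 0 f))"
    by (simp add: of_nat_poly algebra_simps power2_eq_square smult_add_right)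
  then show ?thesis by (simp add: coeff_pCons split: nat.split)
qed

lemma int_binomial_of_nat [simp]: "int_binomial N (int j) = int (N choose j)"
  by (simp add: int_binomial_def)

lemma neg_one_pow_of_nat [simp]: "neg_one_pow (int j) = (- 1) ^ j"
  by (simp add: neg_one_pow_def)

lemma stirling1_odd_prime_cong:
  assumes "prime p" "odd p" "p dvd n" "n > 0"
  shows "\<not> (int p - 1) dvd (int n - k) \<Longrightarrow> [stirling1 n k = 0] (mod int p ^ multiplicity p n)"
    and "int n - k = l * (int p - 1) \<Longrightarrow>
      [stirling1 n k = neg_one_pow l * int_binomial (n div p) l] (mod int p ^ multiplicity p n)"
proof -
  have p2: "p \<ge> 2" using assms(1) by (rule prime_ge_2_nat)
  then have p1: "int p - 1 = int (p - 1)" "p - 1 > 0" by auto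
  note coeffs = stirling1_cong_of_ring_cong[OF rising_prod_odd_prime_cong[OF assms],
      unfolded coeff_one_minus_X_power[OF p1(2)] of_nat_power]
  show "[stirling1 n k = 0] (mod int p ^ multiplicity p n)"
    if "\<not> (int p - 1) dvd (int n - k)"
  proof (cases "k > int n")
    case False
    then obtain i where i: "int n - k = int i" by (metis diff_ge_0_iff_ge not_less zero_le_imp_eq_int)
    from that have "\<not> (p - 1) dvd i" unfolding i p1 int_dvd_int_iff .
    with coeffs[OF i] show ?thesis by simp
  qed (simp add: stirling1_eq_0)
  show "[stirling1 n k = neg_one_pow l * int_binomial (n div p) l] (mod int p ^ multiplicity p n)"
    if l: "int n - k = l * (int p - 1)"
  proof (cases "l < 0")
    case True
    then have "k > int n" using l mult_neg_pos[of l "int p - 1"] p2 by linarith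
    then show ?thesis using True by (simp add: stirling1_eq_0 int_binomial_eq_0)
  next
    case False
    then obtain j where j: "l = int j" by (metis not_less zero_le_imp_eq_int)
    have "int n - k = int (j * (p - 1))"
      using l unfolding j p1(1) of_nat_mult .
    from coeffs[OF this] show ?thesis using p1(2) by (simp add: j)
  qed
qed

lemma stirling1_multiplicity_1_cong:
  assumes "even n"
  shows "[stirling1 n k = int_binomial (n div 2) (int n - k)] (mod 2)"
proof (cases "k > int n")
  case False
  then obtain i where i: "int n - k = int i" by (metis diff_ge_0_iff_ge not_less zero_le_imp_eq_int)
  have "ring_cong (of_nat 2) (rising_prod n polyX) (rising_prod 2 polyX ^ (n div 2))"
    using rising_prod_mult_cong[of 2 "n div 2" polyX] assms by simp
  also have "rising_prod 2 polyX = [:1, 1:]" by (simp add: rising_prod_2 one_pCons)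
  finally have "ring_cong (of_nat 2) (rising_prod n polyX) ([:1, 1:] ^ (n div 2))" .
  moreover have "coeff ([:1, 1:] ^ (n div 2)) i = int (n div 2 choose i)"
    by (cases "i \<le> n div 2")
       (simp_all add: coeff_linear_poly_power coeff_eq_0 degree_linear_power binomial_eq_0)
  ultimately show ?thesis
    using stirling1_cong_of_ring_cong[of 2 n "[:1, 1:] ^ (n div 2)", OF _ i]
    by (simp add: i)
qed (simp add: stirling1_eq_0 int_binomial_eq_0)

lemma stirling1_multiplicity_2_cong:
  assumes "4 dvd n"
  shows "int n - k = 2 * l \<Longrightarrow>
      [stirling1 n k = neg_one_pow l * int_binomial (n div 4) l] (mod 4)"
    and "int n - k = 2 * l + 1 \<Longrightarrow>
      [stirling1 n k = neg_one_pow l * int_binomial (n div 4) l * int (n div 2)] (mod 4)"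
proof -
  obtain m where "n = 4 * m" using assms by blast
  then have "ring_cong (of_nat 4) (rising_prod n polyX)
      ((1 - polyX ^ 2) ^ (n div 4) * (1 + of_nat (n div 2) * polyX))"
    using rising_prod_multiplicity_2_cong[of n m polyX] by simp
  note coeffs = stirling1_cong_of_ring_cong[OF this,
      unfolded coeff_linear_factor coeff_one_minus_X_power[OF zero_less_numeral]]
  show "[stirling1 n k = neg_one_pow l * int_binomial (n div 4) l] (mod 4)"
    if l: "int n - k = 2 * l"
  proof (cases "l < 0")
    case False
    then obtain j where j: "l = int j" by (metis not_less zero_le_imp_eq_int)
    with l have "int n - k = int (2 * j)" by simp
    from coeffs[OF this] show ?thesis
      unfolding j int_binomial_of_nat neg_one_pow_of_nat
      by (cases j) (simp_all del: binomial_Suc_Suc)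
  qed (use l in \<open>simp add: stirling1_eq_0 int_binomial_eq_0\<close>)
  show "[stirling1 n k = neg_one_pow l * int_binomial (n div 4) l * int (n div 2)] (mod 4)"
    if l: "int n - k = 2 * l + 1"
  proof (cases "l < 0")
    case False
    then obtain j where j: "l = int j" by (metis not_less zero_le_imp_eq_int)
    with l have "int n - k = int (Suc (2 * j))" by simp
    from coeffs[OF this] show ?thesis by (simp add: j mult_ac)
  qed (use l in \<open>simp add: stirling1_eq_0 int_binomial_eq_0\<close>)
qed

lemma stirling1_multiplicity_ge_3_cong:
  assumes "2 ^ r dvd n" "r \<ge> 3"
  shows "int n - k = 2 * l + 1 \<Longrightarrow>
      [stirling1 n k = neg_one_pow l * int_binomial (n div 4) l * int (n div 2)] (mod 2 ^ r)"
    and "int n - k = 2 * l \<Longrightarrow>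
      [stirling1 n k = neg_one_pow l *
          (int_binomial (n div 4) l - int (n div 2) * int_binomial (n div 4) (l - 1))] (mod 2 ^ r)"
proof -
  obtain m where "n = 2 ^ r * m" using assms(1) by blast
  from rising_prod_multiplicity_ge_3_cong[OF this assms(2)]
  have "ring_cong (of_nat (2 ^ r)) (rising_prod n polyX)
      ((1 - polyX ^ 2) ^ (n div 4) * (1 + of_nat (n div 2) * (polyX + polyX ^ 2)))" .
  note coeffs = stirling1_cong_of_ring_cong[OF this,
      unfolded coeff_quadratic_factor coeff_one_minus_X_power[OF zero_less_numeral]
        of_nat_power of_nat_numeral]
  show "[stirling1 n k = neg_one_pow l * int_binomial (n div 4) l * int (n div 2)] (mod 2 ^ r)"
    if l: "int n - k = 2 * l + 1"
  proof (cases "l < 0")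
    case False
    then obtain j where j: "l = int j" by (metis not_less zero_le_imp_eq_int)
    with l have "int n - k = int (Suc (2 * j))" by simp
    from coeffs[OF this] show ?thesis
      unfolding j int_binomial_of_nat neg_one_pow_of_nat
      by (cases j) (simp_all add: mult_ac del: binomial_Suc_Suc)
  qed (use l in \<open>simp add: stirling1_eq_0 int_binomial_eq_0\<close>)
  show "[stirling1 n k = neg_one_pow l *
      (int_binomial (n div 4) l - int (n div 2) * int_binomial (n div 4) (l - 1))] (mod 2 ^ r)"
    if l: "int n - k = 2 * l"
  proof (cases "l < 0")
    case False
    then obtain j where j: "l = int j" by (metis not_less zero_le_imp_eq_int)
    with l have i: "int n - k = int (2 * j)" by simp
    show ?thesis
    proof (cases j)
      case 0
      then show ?thesis using coeffs[OF i] by (simp add: j neg_one_pow_def int_binomial_def)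
    next
      case (Suc q)
      then have "l - 1 = int q" by (simp add: j)
      then show ?thesis using coeffs[OF i]
        unfolding \<open>l - 1 = int q\<close> j Suc int_binomial_of_nat neg_one_pow_of_nat
        by (simp add: algebra_simps del: binomial_Suc_Suc)
    qed
  qed (use l in \<open>simp add: stirling1_eq_0 int_binomial_eq_0\<close>)
qed

theorem theorem1p1:
  fixes n :: nat
  assumes "n \<ge> 1"
  shows
    "(\<forall>(p::nat) (k::int). prime p \<and> odd p \<and> p dvd n \<longrightarrow>
        (let r = multiplicity p n in
          (\<not> (int p - 1) dvd (int n - k) \<longrightarrow>
             [stirling1 n k = 0] (mod int p ^ r)) \<and>
          (\<forall>l::int. int n - k = l * (int p - 1) \<longrightarrow>
             [stirling1 n k = neg_one_pow l * int_binomial (n div p) l] (mod int p ^ r))))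
     \<and>
     (even n \<longrightarrow>
        (let r = multiplicity 2 n in \<forall>k::int.
          (r \<ge> 3 \<longrightarrow>
             (\<forall>l::int. int n - k = 2 * l + 1 \<longrightarrow>
                [stirling1 n k = neg_one_pow l * int_binomial (n div 4) l * int (n div 2)]
                  (mod 2 ^ r)) \<and>
             (\<forall>l::int. int n - k = 2 * l \<longrightarrow>
                [stirling1 n k = neg_one_pow l *
                    (int_binomial (n div 4) l - int (n div 2) * int_binomial (n div 4) (l - 1))]
                  (mod 2 ^ r))) \<and>
          (r = 1 \<longrightarrow>
             [stirling1 n k = int_binomial (n div 2) (int n - k)] (mod 2)) \<and>
          (r = 2 \<longrightarrow>
             (\<forall>l::int. int n - k = 2 * l \<longrightarrow>
                [stirling1 n k = neg_one_pow l * int_binomial (n div 4) l] (mod 4)) \<and>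
             (\<forall>l::int. int n - k = 2 * l + 1 \<longrightarrow>
                [stirling1 n k = neg_one_pow l * int_binomial (n div 4) l * int (n div 2)]
                  (mod 4)))))"
proof -
  have "4 dvd n" if "multiplicity 2 n = 2"
    using multiplicity_dvd[of 2 n] that by simp
  then show ?thesis
    using assms stirling1_odd_prime_cong stirling1_multiplicity_ge_3_cong[OF multiplicity_dvd]
      stirling1_multiplicity_1_cong stirling1_multiplicity_2_cong
    unfolding Let_def by simp
qed

end
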